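(* Let $D\subset\Omega\subset\square\subset\mathbb{R}^d$ be Lipschitz domains and let $\mathcal{X}(D)$, $\mathcal{Y}(\Omega)$, $\mathcal{Z}(\square)$ be real normed function spaces on $D$, $\Omega$, $\square$, respectively. Assume that there are a subspace $\mathcal{U}(\square)\subset\mathcal{Z}(\square)$ (equipped with the norm of $\mathcal{Z}(\square)$) and an isomorphism $E_\square\in\mathcal{L}_{\mathrm{is}}(\mathcal{Y}(\Omega),\mathcal{U}(\square))$ with continuous inverse $R_\square:=E_\square^{-1}$, and that there are a subspace $\mathcal{V}(\Omega)\subset\mathcal{Y}(\Omega)$ (equipped with the norm of $\mathcal{Y}(\Omega)$) and an isomorphism $E_D\in\mathcal{L}_{\mathrm{is}}(\mathcal{X}(D),\mathcal{V}(\Omega))$ with continuous inverse $R_D:=E_D^{-1}$. Set $C_\square:=\|E_\square\|_{\mathcal{L}(\mathcal{Y}(\Omega),\mathcal{U}(\square))}$ and $C_D:=\|E_D\|_{\mathcal{L}(\mathcal{X}(D),\mathcal{V}(\Omega))}$. Let $r_\Omega\in\mathcal{Y}'(\Omega)$ be given and let $r_D:=E_D'\big(r_\Omega|_{\mathcal{V}(\Omega)}\big)\in\mathcal{X}'(D)$, where $r_\Omega|_{\mathcal{V}(\Omega)}$ is the restriction of $r_\Omega:\mathcal{Y}(\Omega)\to\mathbb{R}$ to $\mathcal{V}(\Omega)$. Then $$\frac{1}{C_D}\,\|r_D\|_{\mathcal{X}'(D)}\le\|r_\Omega\|_{\mathcal{Y}'(\Omega)}\le C_\square\,\|r_\square\|_{\mathcal{Z}'(\square)}\qquad\text{for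 all } r_\square\in\mathcal{E}(R_\square' r_\Omega;\mathcal{Z}'(\square)).$$
   Context: All spaces are real. The function spaces are understood to be nonzero. For normed spaces $A,B$, $\mathcal{L}(A,B)$ is the space of continuous linear maps with the operator norm, and $\mathcal{L}_{\mathrm{is}}(A,B)$ is the set of linear bijections $A\to B$ that are continuous with continuous inverse. $A'$ is the topological dual of $A$ with norm $\|f\|_{A'}=\sup_{0\ne v\in A} f(v)/\|v\|_A$. For $T\in\mathcal{L}(A,B)$ the adjoint $T'\in\mathcal{L}(B',A')$ is $T'g=g\circ T$; in particular $R_\square' r_\Omega\in\mathcal{U}'(\square)$ is $u\mapsto r_\Omega(R_\square u)$, and $E_D' s\in\mathcal{X}'(D)$ is $v\mapsto s(E_D v)$. For a subspace $A\subset B$ (with inherited norm) and $r\in A'$, the set of all continuous extensions is $\mathcal{E}(r;B'):=\{\tilde r\in B':\tilde r=r\text{ on }A\}$. *)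

theory Defs
  imports "HOL-Analysis.Analysis"
begin

(* In suitable Cartesian coordinates (vertical direction n, horizontal part y - (y . n) n),
   the set is locally the strict epigraph of a Lipschitz function.  Boundedness is not required. *)
definition lipschitz_domain :: "(real ^ 'd) set \<Rightarrow> bool" where
  "lipschitz_domain S \<longleftrightarrow>
     S \<noteq> {} \<and> open S \<and> connected S \<and>
     (\<forall>x \<in> frontier S. \<exists>W n L \<gamma>.
        open W \<and> x \<in> W \<and> norm n = 1 \<and> L-lipschitz_on {z. z \<bullet> n = 0} \<gamma> \<and>
        S \<inter> W = {y \<in> W. y \<bullet> n > (\<gamma> (y - (y \<bullet> n) *\<^sub>R n) :: real)})"

(* The normed space 'a is a space of functions on S with values in 'v.  The set rep x consists
   of the functions representing the element x; only their values on S matter.  Representatives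
   of the same element may differ on a null set, so both spaces of genuine functions (such as
   continuous functions) and spaces of almost-everywhere classes (such as Lebesgue or Sobolev
   spaces) are covered.  The norm is that of the type 'a. *)
definition function_space_on ::
    "(real ^ 'd) set \<Rightarrow> ('a::real_normed_vector \<Rightarrow> (real ^ 'd \<Rightarrow> 'v::real_vector) set) \<Rightarrow> bool" where
  "function_space_on S rep \<longleftrightarrow>
     (\<forall>x. rep x \<noteq> {}) \<and>
     (\<forall>x f g. f \<in> rep x \<longrightarrow> (\<forall>t\<in>S. f t = g t) \<longrightarrow> g \<in> rep x) \<and>
     (\<forall>x f g. f \<in> rep x \<longrightarrow> g \<in> rep x \<longrightarrow> (AE t in lebesgue. t \<in> S \<longrightarrow> f t = g t)) \<and>
     (\<forall>x y f. f \<in> rep x \<longrightarrow> f \<in> rep y \<longrightarrow> x = y) \<and>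
     (\<forall>x y f g. f \<in> rep x \<longrightarrow> g \<in> rep y \<longrightarrow> (\<lambda>t. f t + g t) \<in> rep (x + y)) \<and>
     (\<forall>x c f. f \<in> rep x \<longrightarrow> (\<lambda>t. c *\<^sub>R f t) \<in> rep (c *\<^sub>R x))"

(* Isomorphisms from the whole space 'a onto a subspace B of 'b, where B carries the norm of 'b;
   the operator norm of such a map into B is therefore its onorm as a map into 'b. *)
definition L_is :: "'b set \<Rightarrow> ('a::real_normed_vector \<Rightarrow> 'b::real_normed_vector) set" where
  "L_is B = {T. bounded_linear T \<and> bij_betw T UNIV B \<and> continuous_on B (inv_into UNIV T)}"

definition dual_norm :: "('a::real_normed_vector \<Rightarrow> real) \<Rightarrow> real" where
  "dual_norm f = (SUP v\<in>UNIV - {0}. f v / norm v)"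

(* The adjoint of T : A -> B, applied to a functional g on B.  Functionals on a subspace are
   represented by functions that are undefined outside it. *)
definition dual_adjoint :: "'a set \<Rightarrow> ('a \<Rightarrow> 'b) \<Rightarrow> ('b \<Rightarrow> real) \<Rightarrow> 'a \<Rightarrow> real" where
  "dual_adjoint A T g = (\<lambda>v\<in>A. g (T v))"

definition continuous_extensions ::
    "'b set \<Rightarrow> ('b::real_normed_vector \<Rightarrow> real) \<Rightarrow> ('b \<Rightarrow> real) set" where
  "continuous_extensions A r = {r'. bounded_linear r' \<and> (\<forall>v\<in>A. r' v = r v)}"

end

theory Submission
  imports Defs
begin

text \<open>
  Both estimates are instances of \<open>\<parallel>g \<circ> T\<parallel> \<le> \<parallel>T\<parallel> \<parallel>g\<parallel>\<close> for the dual norm: \<open>r_D\<close> is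
  \<open>r_\<Omega> \<circ> E_D\<close>, and \<open>r_\<Omega>\<close> is \<open>r_Box \<circ> E_Box\<close> for every extension \<open>r_Box\<close>, because
  \<open>R_Box\<close> inverts \<open>E_Box\<close> and \<open>r_Box\<close> is prescribed on the range of \<open>E_Box\<close>.
\<close>

lemma le_dual_norm:
  fixes f :: "'a::real_normed_vector \<Rightarrow> real"
  assumes "bounded_linear f"
  shows "f v \<le> dual_norm f * norm v"
proof (cases "v = 0")
  case True
  then show ?thesis
    using assms by (simp add: linear_simps)
next
  case False
  \<comment> \<open>A real \<open>SUP\<close> dominates its members only when they are bounded
    above; the operator norm supplies that bound.\<close>
  have "f w / norm w \<le> onorm f" for w
    using le_onorm[OF assms, of w] divide_right_mono[OF abs_ge_self, of "norm w" "f w"] by simp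
  then have "bdd_above ((\<lambda>w. f w / norm w) ` (UNIV - {0}))"
    by (rule bdd_aboveI2)
  then have "f v / norm v \<le> dual_norm f"
    unfolding dual_norm_def using False by (intro cSUP_upper) auto
  then show ?thesis
    using False by (simp add: pos_divide_le_eq)
qed

lemma dual_norm_le:
  fixes f :: "'a::real_normed_vector \<Rightarrow> real"
  assumes "\<exists>v::'a. v \<noteq> 0" and "\<And>v. f v \<le> c * norm v"
  shows "dual_norm f \<le> c"
  unfolding dual_norm_def
  using assms by (intro cSUP_least) (auto simp: pos_divide_le_eq)

text \<open>The supremum runs over signed quotients, so its sign is not immediate. Since
  \<open>f\<close> takes opposite values at \<open>v\<close> and \<open>- v\<close>, adding the two
  estimates for a nonzero \<open>v\<close> cancels them.\<close>

lemma dual_norm_nonneg: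
  fixes f :: "'a::real_normed_vector \<Rightarrow> real"
  assumes "bounded_linear f" and "\<exists>v::'a. v \<noteq> 0"
  shows "0 \<le> dual_norm f"
proof -
  obtain v :: 'a where "v \<noteq> 0"
    using assms(2) by blast
  moreover have "f (- v) = - f v"
    using assms(1) by (simp add: linear_simps)
  ultimately have "0 \<le> dual_norm f * norm v"
    using le_dual_norm[OF assms(1), of v] le_dual_norm[OF assms(1), of "- v"] by simp
  with \<open>v \<noteq> 0\<close> show ?thesis
    by (simp add: zero_le_mult_iff)
qed

lemma dual_norm_comp_le:
  fixes T :: "'a::real_normed_vector \<Rightarrow> 'b::real_normed_vector"
  assumes "bounded_linear T" and "bounded_linear g"
    and "\<exists>v::'a. v \<noteq> 0" and "\<exists>w::'b. w \<noteq> 0"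
  shows "dual_norm (\<lambda>v. g (T v)) \<le> onorm T * dual_norm g"
proof (rule dual_norm_le[OF assms(3)])
  fix v
  have "g (T v) \<le> dual_norm g * norm (T v)"
    by (rule le_dual_norm[OF assms(2)])
  \<comment> \<open>Here \<open>'b\<close> must be nonzero: the factor \<open>dual_norm g\<close>
    has to be nonnegative.\<close>
  also have "\<dots> \<le> dual_norm g * (onorm T * norm v)"
    using onorm[OF assms(1)] dual_norm_nonneg[OF assms(2,4)] by (rule mult_left_mono)
  finally show "g (T v) \<le> onorm T * dual_norm g * norm v"
    by (simp add: ac_simps)
qed

theorem theorem3p6:
  fixes D \<Omega> Box :: "(real ^ 'd) set"
    and repX :: "'x::real_normed_vector \<Rightarrow> (real ^ 'd \<Rightarrow> 'v::real_vector) set"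
    and repY :: "'y::real_normed_vector \<Rightarrow> (real ^ 'd \<Rightarrow> 'v) set"
    and repZ :: "'z::real_normed_vector \<Rightarrow> (real ^ 'd \<Rightarrow> 'v) set"
    and U :: "'z set" and V :: "'y set"
    and E_Box :: "'y \<Rightarrow> 'z" and R_Box :: "'z \<Rightarrow> 'y"
    and E_D :: "'x \<Rightarrow> 'y" and R_D :: "'y \<Rightarrow> 'x"
    and C_Box C_D :: real
    and r_\<Omega> :: "'y \<Rightarrow> real" and r_D :: "'x \<Rightarrow> real"
  assumes "lipschitz_domain D" and "lipschitz_domain \<Omega>" and "lipschitz_domain Box"
    and "D \<subseteq> \<Omega>" and "\<Omega> \<subseteq> Box"
    and "function_space_on D repX" and "function_space_on \<Omega> repY" and "function_space_on Box repZ"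
    and "\<exists>v::'x. v \<noteq> 0" and "\<exists>v::'y. v \<noteq> 0" and "\<exists>v::'z. v \<noteq> 0"
    and "subspace U" and "E_Box \<in> L_is U" and "R_Box = inv_into UNIV E_Box"
    and "subspace V" and "E_D \<in> L_is V" and "R_D = inv_into UNIV E_D"
    and "C_Box = onorm E_Box" and "C_D = onorm E_D"
    and "bounded_linear r_\<Omega>"
    and "r_D = dual_adjoint UNIV E_D (restrict r_\<Omega> V)"
  shows "1 / C_D * dual_norm r_D \<le> dual_norm r_\<Omega> \<and>
         (\<forall>r_Box \<in> continuous_extensions U (dual_adjoint U R_Box r_\<Omega>).
            dual_norm r_\<Omega> \<le> C_Box * dual_norm r_Box)"
proof -
  have E_D: "bounded_linear E_D" "\<And>x. E_D x \<in> V"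
    using \<open>E_D \<in> L_is V\<close> by (auto simp: L_is_def bij_betw_def)
  have E_Box: "bounded_linear E_Box" "\<And>y. E_Box y \<in> U" "inj E_Box"
    using \<open>E_Box \<in> L_is U\<close> by (auto simp: L_is_def bij_betw_def)
  \<comment> \<open>The restriction is \<open>undefined\<close> off \<open>V\<close>, but
    \<open>E_D\<close> only takes values in \<open>V\<close>.\<close>
  have "r_D = (\<lambda>x. r_\<Omega> (E_D x))"
    using \<open>r_D = _\<close> E_D(2) by (auto simp: dual_adjoint_def)
  then have "dual_norm r_D \<le> C_D * dual_norm r_\<Omega>"
    using dual_norm_comp_le[OF E_D(1) \<open>bounded_linear r_\<Omega>\<close>] assms(9,10) \<open>C_D = _\<close> by simp
  moreover have "0 \<le> C_D"
    using \<open>C_D = _\<close> onorm_pos_le[OF E_D(1)] by simp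
  moreover have "0 \<le> dual_norm r_\<Omega>"
    using \<open>bounded_linear r_\<Omega>\<close> assms(10) by (rule dual_norm_nonneg)
  \<comment> \<open>No proof of \<open>C_D > 0\<close> is required: if \<open>C_D = 0\<close>, then
    \<open>1 / C_D = 0\<close> and the claim is nonnegativity of the dual norm.\<close>
  ultimately have "1 / C_D * dual_norm r_D \<le> dual_norm r_\<Omega>"
    by (auto simp: divide_le_eq mult.commute)
  moreover have "dual_norm r_\<Omega> \<le> C_Box * dual_norm r_Box"
    if "r_Box \<in> continuous_extensions U (dual_adjoint U R_Box r_\<Omega>)" for r_Box
  proof -
    \<comment> \<open>Injectivity of \<open>E_Box\<close> makes \<open>inv_into\<close> return
      exactly \<open>y\<close> at \<open>E_Box y\<close>.\<close>
    have "bounded_linear r_Box" and "r_Box (E_Box y) = r_\<Omega> y" for y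
      using that E_Box(2,3) \<open>R_Box = _\<close>
      by (auto simp: continuous_extensions_def dual_adjoint_def)
    then show ?thesis
      using dual_norm_comp_le[OF E_Box(1), of r_Box] assms(10,11) \<open>C_Box = _\<close> by simp
  qed
  ultimately show ?thesis
    by blast
qed

end
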